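(* Let $f:\mathbb R^m\to\mathbb R$ be convex and $C^2$ with an attained minimum $f^\star=f(u^\star)$, $F=f-f^\star$, and let $\mathcal B$ be a partition of the coordinates with finite $\kappa_B,\nu_B\ge0$, not both zero for any $B\in\mathcal B$, such that $0\preceq\nabla^2_{BB}f(u)\preceq(\kappa_B+\nu_BF(u))I_B$ for all $u\in\mathbb R^m$ and $B\in\mathcal B$. Put $C_0=\sum_B\sqrt{\kappa_B}$, $C_1=\sum_B\sqrt{\nu_B}$. Let $T,a,\Pi>0$, put $T_+=T+a$ and $\Delta=\Pi/T$, and let $M=C_0+\sqrt{5\Delta}\,C_1$ satisfy $M^2a^2=T_+$. If $u,v\in\mathbb R^m$ satisfy $$TF(u)+\tfrac12\|v-u^\star\|_2^2\le\Pi,\qquad\text{and}\qquad y:=\frac{Tu+av}{T_+},$$ then $F(y)\le4\Delta$. Consequently every block bound $\bar L_B$ defined by $\sqrt{\bar L_B}:=\sqrt{\kappa_B}+\sqrt{5\nu_B\Delta}$ is valid at $y$, $$\nabla^2_{BB}f(y)\preceq\bar L_BI_B,$$ and the point $y-U_B\nabla_Bf(y)/\bar L_B$ decreases $f$ by at least $\|\nabla_Bf(y)\|_2^2/(2\bar L_B)$ relative to $f(y)$.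
   Context: $\nabla^2_{BB}f$ is the diagonal Hessian block indexed by $B$, $\nabla_Bf$ the block gradient, $U_B:\mathbb R^{|B|}\to\mathbb R^m$ the zero-padding injection, $\preceq$ the Loewner order. $u^\star$ is any fixed minimizer of $f$. *)

theory Defs
  imports "HOL-Analysis.Analysis"
begin

definition gradient :: "('a::real_inner \<Rightarrow> real) \<Rightarrow> 'a \<Rightarrow> 'a" where
  "gradient f x = (THE D. GDERIV f x :> D)"

definition hessian :: "(real ^ 'n \<Rightarrow> real) \<Rightarrow> real ^ 'n \<Rightarrow> real ^ 'n ^ 'n" where
  "hessian f x = jacobian (gradient f) (at x)"

text \<open>The differentiability clauses make \<^const>\<open>gradient\<close> and \<^const>\<open>hessian\<close> meaningful at
  every point. Continuity of \<open>f\<close> and of its gradient follows from differentiability.\<close>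

definition twice_cont_diff :: "(real ^ 'n \<Rightarrow> real) \<Rightarrow> bool" where
  "twice_cont_diff f \<longleftrightarrow>
     (\<forall>x. f differentiable (at x)) \<and>
     (\<forall>x. gradient f differentiable (at x)) \<and>
     continuous_on UNIV (hessian f)"

text \<open>For a set \<open>B\<close> of coordinates, vectors of dimension \<open>card B\<close> are represented as functions
  \<open>'n \<Rightarrow> real\<close> and square matrices of that size as functions \<open>'n \<Rightarrow> 'n \<Rightarrow> real\<close>, of which only
  the values at indices in \<open>B\<close> matter. The Euclidean norm on such vectors is
  \<open>\<lambda>z. L2_set z B\<close>.\<close>

definition gradient_block :: "(real ^ 'n \<Rightarrow> real) \<Rightarrow> 'n set \<Rightarrow> real ^ 'n \<Rightarrow> 'n \<Rightarrow> real" where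
  "gradient_block f B x = (\<lambda>i\<in>B. gradient f x $ i)"

definition hessian_block :: "(real ^ 'n \<Rightarrow> real) \<Rightarrow> 'n set \<Rightarrow> real ^ 'n \<Rightarrow> 'n \<Rightarrow> 'n \<Rightarrow> real" where
  "hessian_block f B x = (\<lambda>i\<in>B. \<lambda>j\<in>B. hessian f x $ i $ j)"

definition zero_pad :: "'n set \<Rightarrow> ('n \<Rightarrow> real) \<Rightarrow> real ^ 'n" where
  "zero_pad B z = (\<chi> i. if i \<in> B then z i else 0)"

definition scaled_id :: "real \<Rightarrow> 'n \<Rightarrow> 'n \<Rightarrow> real" where
  "scaled_id c = (\<lambda>i j. if i = j then c else 0)"

definition psd_on :: "'n set \<Rightarrow> ('n \<Rightarrow> 'n \<Rightarrow> real) \<Rightarrow> bool" where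
  "psd_on B A \<longleftrightarrow>
     (\<forall>i\<in>B. \<forall>j\<in>B. A i j = A j i) \<and>
     (\<forall>z :: 'n \<Rightarrow> real. 0 \<le> (\<Sum>i\<in>B. \<Sum>j\<in>B. z i * A i j * z j))"

definition loewner_le_on :: "'n set \<Rightarrow> ('n \<Rightarrow> 'n \<Rightarrow> real) \<Rightarrow> ('n \<Rightarrow> 'n \<Rightarrow> real) \<Rightarrow> bool" where
  "loewner_le_on B A A' \<longleftrightarrow> psd_on B (\<lambda>i j. A' i j - A i j)"

end

theory Submission
  imports Defs
begin

text \<open>Curvature is controlled by the function value: where \<open>F \<le> 5 \<Delta>\<close>, block \<open>B\<close> has curvature at
  most \<open>\<kappa>\<^sub>B + 5 \<nu>\<^sub>B \<Delta> \<le> Lbar\<^sub>B\<close>. The square root of a convex function's Hessian form is a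
  seminorm, so adding up blocks shows that the full Hessian is at most \<open>M\<^sup>2\<close> there, because
  \<open>M\<close> is exactly the sum of the \<open>sqrt (Lbar\<^sub>B)\<close> (\<open>block_bounds_imp_hessian_bound\<close>).

  The value of \<open>f\<close> at \<open>v\<close> is unknown, so \<open>y\<close> is compared with the point
  \<open>w = (T u + a u\<^sup>*) / T\<^sub>+\<close> in place of a convex combination of values at \<open>u\<close> and \<open>v\<close>. Convexity
  gives \<open>F w \<le> T F u / T\<^sub>+ \<le> \<Delta>\<close>, and \<open>d = y - w = (a / T\<^sub>+) (v - u\<^sup>*)\<close> is short: by
  \<open>M\<^sup>2 a\<^sup>2 = T\<^sub>+\<close> and the potential bound, \<open>M\<^sup>2 |d|\<^sup>2 \<le> 2 \<Pi> / T\<^sub>+ \<le> 2 \<Delta>\<close>. Since \<open>F \<ge> 0\<close>, the slope at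
  \<open>w\<close> along \<open>d\<close> is at most \<open>sqrt (2 * 2 \<Delta> * \<Delta>) = 2 \<Delta>\<close> (\<open>directional_derivative_bound\<close>), and
  the quadratic model from \<open>w\<close> to \<open>y\<close> never exceeds \<open>\<Delta> + 2 \<Delta> + \<Delta> = 4 \<Delta>\<close>.

  The curvature bounds hold only on a sublevel set, so each use of Taylor's formula has to rule out
  leaving that set. For convex functions this follows by looking at the first return or crossing:
  values on a segment are bounded by those at its ends, so Taylor's formula applies up to the
  crossing and forbids it. For growth from \<open>w\<close> this is \<open>convex_Taylor_barrier\<close>, which exploits the
  gap between \<open>4 \<Delta>\<close> and \<open>5 \<Delta>\<close>; for descent steps it is \<open>convex_descent_step\<close>, which yields both
  the slope bound at \<open>w\<close> and the decrease of the block step at \<open>y\<close>.\<close>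

section \<open>Convex functions of one real variable\<close>

lemma convex_imp_second_derivative_nonneg:
  fixes \<phi> :: "real \<Rightarrow> real"
  assumes convex: "convex_on UNIV \<phi>"
    and d1: "\<And>t. (\<phi> has_real_derivative \<phi>' t) (at t)"
    and d2: "(\<phi>' has_real_derivative D) (at t)"
  shows "0 \<le> D"
proof -
  have tangent: "\<phi> r - \<phi> s \<ge> \<phi>' s * (r - s)" for r s
    using convex_on_imp_above_tangent[OF convex, of s r "\<phi>' s"] d1[of s] by simp
  have "mono_on UNIV \<phi>'"
  proof (rule mono_onI)
    fix r s :: real assume "r \<le> s"
    show "\<phi>' r \<le> \<phi>' s"
    proof (cases "r = s")
      case False
      have "(\<phi>' s - \<phi>' r) * (s - r) \<ge> 0"
        using tangent[of r s] tangent[of s r] by (simp add: algebra_simps)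
      then show ?thesis
        using False \<open>r \<le> s\<close> by (simp add: zero_le_mult_iff)
    qed simp
  qed
  from mono_on_imp_deriv_nonneg[OF this d2] show ?thesis by simp
qed

text \<open>On a segment a convex function is at most the larger of its two end values, so a bound on
  the second derivative that is known only on a sublevel set applies to the whole segment as soon
  as both ends lie in that set.\<close>

lemma convex_Taylor_upper_bound:
  fixes \<phi> :: "real \<Rightarrow> real"
  assumes convex: "convex_on UNIV \<phi>"
    and d1: "\<And>t. (\<phi> has_real_derivative \<phi>' t) (at t)"
    and d2: "\<And>t. (\<phi>' has_real_derivative \<phi>'' t) (at t)"
    and bound: "\<And>t. \<phi> t \<le> R \<Longrightarrow> \<phi>'' t \<le> K"
    and ends: "\<phi> 0 \<le> R" "\<phi> s \<le> R"
    and "0 < s"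
  shows "\<phi> s \<le> \<phi> 0 + \<phi>' 0 * s + K * s\<^sup>2 / 2"
proof -
  define diff where "diff = (\<lambda>n::nat. if n = 0 then \<phi> else if n = 1 then \<phi>' else \<phi>'')"
  have "\<exists>t. 0 < t \<and> t < s \<and>
      \<phi> s = (\<Sum>m<2. (diff m 0 / fact m) * s ^ m) + (diff 2 t / fact 2) * s ^ 2"
    by (rule Maclaurin) (use \<open>0 < s\<close> d1 d2 in \<open>auto simp: diff_def less_2_cases_iff\<close>)
  then obtain t where t: "0 < t" "t < s"
    and eq: "\<phi> s = \<phi> 0 + \<phi>' 0 * s + \<phi>'' t / 2 * s\<^sup>2"
    by (auto simp: diff_def numeral_2_eq_2)
  have t_convex_comb: "t = (1 - t / s) *\<^sub>R 0 + (t / s) *\<^sub>R s"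
    using \<open>0 < s\<close> by simp
  have "\<phi> t \<le> (1 - t / s) * \<phi> 0 + (t / s) * \<phi> s"
    using convex_onD[OF convex, of "t / s" 0 s] t \<open>0 < s\<close> t_convex_comb by simp
  also have "\<dots> \<le> (1 - t / s) * R + (t / s) * R"
    using ends t \<open>0 < s\<close> by (intro add_mono mult_left_mono) auto
  also have "\<dots> = R" by (simp add: algebra_simps)
  finally have "\<phi>'' t \<le> K" by (rule bound)
  then have "\<phi>'' t / 2 * s\<^sup>2 \<le> K / 2 * s\<^sup>2"
    by (intro mult_right_mono) auto
  with eq show ?thesis by simp
qed

text \<open>The step to the minimizer of the quadratic model cannot leave the initial sublevel set: the
  function first decreases, so leaving would mean returning to the value \<open>\<phi> 0\<close> before the step
  \<open>- \<phi>' 0 / K\<close>, while the quadratic upper bound allows such a return only after twice that step.\<close>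

lemma convex_descent_step:
  fixes \<phi> :: "real \<Rightarrow> real"
  assumes convex: "convex_on UNIV \<phi>"
    and d1: "\<And>t. (\<phi> has_real_derivative \<phi>' t) (at t)"
    and d2: "\<And>t. (\<phi>' has_real_derivative \<phi>'' t) (at t)"
    and bound: "\<And>t. \<phi> t \<le> \<phi> 0 \<Longrightarrow> \<phi>'' t \<le> K"
    and "0 < K" and "\<phi>' 0 < 0"
  shows "\<phi> (- \<phi>' 0 / K) \<le> \<phi> 0 - (\<phi>' 0)\<^sup>2 / (2 * K)"
proof -
  define \<tau> where "\<tau> = - \<phi>' 0 / K"
  have \<tau>: "0 < \<tau>" "\<phi>' 0 = - K * \<tau>"
    using \<open>0 < K\<close> \<open>\<phi>' 0 < 0\<close> by (auto simp: \<tau>_def field_simps)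
  have "\<phi> \<tau> \<le> \<phi> 0"
  proof (rule ccontr)
    assume "\<not> \<phi> \<tau> \<le> \<phi> 0"
    obtain \<delta> where "\<delta> > 0" and dec: "\<And>h. 0 < h \<Longrightarrow> h < \<delta> \<Longrightarrow> \<phi> h < \<phi> 0"
      using DERIV_neg_dec_right[OF d1 \<open>\<phi>' 0 < 0\<close>] by auto
    define h where "h = min (\<delta> / 2) (\<tau> / 2)"
    have h: "0 < h" "h < \<delta>" "h < \<tau>"
      using \<open>\<delta> > 0\<close> \<tau> by (auto simp: h_def min_def)
    have "\<exists>s. h \<le> s \<and> s \<le> \<tau> \<and> \<phi> s = \<phi> 0"
      by (rule IVT) (use h dec[of h] \<open>\<not> \<phi> \<tau> \<le> \<phi> 0\<close> d1 in \<open>auto intro: DERIV_isCont\<close>)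
    then obtain s where "h \<le> s" and "s \<le> \<tau>" "\<phi> s = \<phi> 0" by blast
    with h have s: "0 < s" "s \<le> \<tau>" "\<phi> s = \<phi> 0" by auto
    have "\<phi> s \<le> \<phi> 0 + \<phi>' 0 * s + K * s\<^sup>2 / 2"
      by (rule convex_Taylor_upper_bound[OF convex d1 d2 bound, where s = s]) (use s in auto)
    then have "0 \<le> (K * s) * (s / 2 - \<tau>)"
      using s \<tau> by (simp add: algebra_simps power2_eq_square)
    moreover have "0 < K * s" using s \<open>0 < K\<close> by simp
    ultimately have "0 \<le> s / 2 - \<tau>"
      using zero_le_mult_iff[of "K * s" "s / 2 - \<tau>"] by linarith
    with s show False by simp
  qed
  then have "\<phi> \<tau> \<le> \<phi> 0 + \<phi>' 0 * \<tau> + K * \<tau>\<^sup>2 / 2"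
    by (intro convex_Taylor_upper_bound[OF convex d1 d2 bound]) (use \<tau> in auto)
  also have "\<dots> = \<phi> 0 - (\<phi>' 0)\<^sup>2 / (2 * K)"
    using \<open>0 < K\<close> unfolding \<tau>(2) by (simp add: field_simps power2_eq_square)
  finally show ?thesis by (simp add: \<tau>_def)
qed

text \<open>A barrier argument: if the quadratic model stays below \<open>c\<close>, strictly inside the sublevel set
  on which it is an upper bound, then \<open>\<phi>\<close> cannot exceed \<open>c\<close>, since it would first have to pass
  through values between \<open>c\<close> and \<open>R\<close>, where the model already forbids them.\<close>

lemma convex_Taylor_barrier:
  fixes \<phi> :: "real \<Rightarrow> real"
  assumes convex: "convex_on UNIV \<phi>"
    and d1: "\<And>t. (\<phi> has_real_derivative \<phi>' t) (at t)"
    and d2: "\<And>t. (\<phi>' has_real_derivative \<phi>'' t) (at t)"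
    and bound: "\<And>t. \<phi> t \<le> R \<Longrightarrow> \<phi>'' t \<le> K"
    and "c < R"
    and model: "\<And>s. 0 \<le> s \<Longrightarrow> s \<le> 1 \<Longrightarrow> \<phi> 0 + \<phi>' 0 * s + K * s\<^sup>2 / 2 \<le> c"
  shows "\<phi> 1 \<le> c"
proof (rule ccontr)
  assume "\<not> \<phi> 1 \<le> c"
  define b where "b = min (\<phi> 1) R"
  have b: "c < b" "b \<le> \<phi> 1" "b \<le> R"
    using \<open>\<not> \<phi> 1 \<le> c\<close> \<open>c < R\<close> by (auto simp: b_def)
  have "\<phi> 0 \<le> c" using model[of 0] by simp
  have "\<exists>s. 0 \<le> s \<and> s \<le> 1 \<and> \<phi> s = b"
    by (rule IVT) (use b \<open>\<phi> 0 \<le> c\<close> d1 in \<open>auto intro: DERIV_isCont\<close>)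
  then obtain s where s: "0 \<le> s" "s \<le> 1" "\<phi> s = b" by auto
  have "s \<noteq> 0" using s b \<open>\<phi> 0 \<le> c\<close> by auto
  then have "\<phi> s \<le> \<phi> 0 + \<phi>' 0 * s + K * s\<^sup>2 / 2"
    by (intro convex_Taylor_upper_bound[OF convex d1 d2 bound, where R = R])
       (use s b \<open>\<phi> 0 \<le> c\<close> in auto)
  with model[of s] s b show False by simp
qed

section \<open>Restriction to lines\<close>

lemma has_derivative_gradient:
  fixes f :: "real ^ 'n \<Rightarrow> real"
  assumes "f differentiable (at x)"
  shows "(f has_derivative (\<lambda>h. h \<bullet> gradient f x)) (at x)"
proof -
  obtain f' where f': "(f has_derivative f') (at x)"
    using assms by (auto simp: differentiable_def)
  then have lin: "linear f'" by (rule has_derivative_linear)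
  define D where "D = (\<chi> i. f' (axis i 1))"
  have "f' h = h \<bullet> D" for h
  proof -
    have "f' h = f' (\<Sum>i\<in>UNIV. h $ i *\<^sub>R axis i 1)"
      using basis_expansion[of h] by (simp add: scalar_mult_eq_scaleR)
    also have "\<dots> = (\<Sum>i\<in>UNIV. h $ i * f' (axis i 1))"
      by (simp add: linear_sum[OF lin] linear_cmul[OF lin])
    finally show ?thesis by (simp add: D_def inner_vec_def)
  qed
  then have "f' = (\<lambda>h. h \<bullet> D)" by (rule ext)
  with f' have D: "GDERIV f x :> D" by (simp add: gderiv_def)
  have "E = D" if "GDERIV f x :> E" for E
  proof -
    have "(\<lambda>h. h \<bullet> E) = (\<lambda>h. h \<bullet> D)"
      using that D unfolding gderiv_def by (rule has_derivative_unique)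
    then have "h \<bullet> E = h \<bullet> D" for h by (rule fun_cong)
    then show ?thesis using vector_eq_ldot[of E D] by blast
  qed
  with D have "GDERIV f x :> gradient f x"
    unfolding gradient_def by (rule theI)
  then show ?thesis by (simp add: gderiv_def)
qed

lemma line_first_derivative:
  fixes f :: "real ^ 'n \<Rightarrow> real"
  assumes "twice_cont_diff f"
  shows "((\<lambda>t. f (x + t *\<^sub>R d)) has_real_derivative d \<bullet> gradient f (x + t *\<^sub>R d)) (at t)"
proof -
  have "(f has_derivative (\<lambda>h. h \<bullet> gradient f (x + t *\<^sub>R d))) (at (x + t *\<^sub>R d))"
    using assms by (intro has_derivative_gradient) (simp add: twice_cont_diff_def)
  moreover have "((\<lambda>t. x + t *\<^sub>R d) has_derivative (\<lambda>h. h *\<^sub>R d)) (at t)"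
    by (auto intro!: derivative_eq_intros)
  ultimately have "((\<lambda>t. f (x + t *\<^sub>R d)) has_derivative
      (\<lambda>h. (h *\<^sub>R d) \<bullet> gradient f (x + t *\<^sub>R d))) (at t)"
    by (rule has_derivative_compose[rotated])
  then show ?thesis
    by (simp add: has_field_derivative_def mult.commute[of _ "d \<bullet> _"] )
qed

lemma line_second_derivative:
  fixes f :: "real ^ 'n \<Rightarrow> real"
  assumes "twice_cont_diff f"
  shows "((\<lambda>t. d \<bullet> gradient f (x + t *\<^sub>R d)) has_real_derivative
    d \<bullet> (hessian f (x + t *\<^sub>R d) *v d)) (at t)"
proof -
  let ?H = "hessian f (x + t *\<^sub>R d)"
  have "(gradient f has_derivative (\<lambda>h. ?H *v h)) (at (x + t *\<^sub>R d))"
    using assms unfolding hessian_def by (subst jacobian_works[symmetric]) (simp add: twice_cont_diff_def)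
  moreover have "((\<lambda>t. x + t *\<^sub>R d) has_derivative (\<lambda>h. h *\<^sub>R d)) (at t)"
    by (auto intro!: derivative_eq_intros)
  ultimately have "((\<lambda>t. gradient f (x + t *\<^sub>R d)) has_derivative (\<lambda>h. ?H *v (h *\<^sub>R d))) (at t)"
    by (rule has_derivative_compose[rotated])
  then have "((\<lambda>t. d \<bullet> gradient f (x + t *\<^sub>R d)) has_derivative (\<lambda>h. d \<bullet> (?H *v (h *\<^sub>R d)))) (at t)"
    by (rule has_derivative_inner_right)
  then show ?thesis
    by (simp add: has_field_derivative_def matrix_vector_mult_scaleR mult.commute[of _ "d \<bullet> _"])
qed

lemma convex_on_line:
  fixes f :: "'a::real_vector \<Rightarrow> real"
  assumes "convex_on UNIV f"
  shows "convex_on UNIV (\<lambda>t. f (x + t *\<^sub>R d))"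
proof (rule convex_onI)
  fix t r s :: real assume "0 < t" "t < 1"
  have "x + ((1 - t) *\<^sub>R r + t *\<^sub>R s) *\<^sub>R d = (1 - t) *\<^sub>R (x + r *\<^sub>R d) + t *\<^sub>R (x + s *\<^sub>R d)"
    by (simp add: algebra_simps)
  then show "f (x + ((1 - t) *\<^sub>R r + t *\<^sub>R s) *\<^sub>R d)
      \<le> (1 - t) * f (x + r *\<^sub>R d) + t * f (x + s *\<^sub>R d)"
    using convex_onD[OF assms, of t] \<open>0 < t\<close> \<open>t < 1\<close> by simp
qed simp

lemma convex_imp_hessian_nonneg:
  fixes f :: "real ^ 'n \<Rightarrow> real"
  assumes "convex_on UNIV f" and C2: "twice_cont_diff f"
  shows "0 \<le> d \<bullet> (hessian f x *v d)"
  using convex_imp_second_derivative_nonneg[OF convex_on_line[OF assms(1)]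
      line_first_derivative[OF C2] line_second_derivative[OF C2], of d x 0] by simp

lemma convex_directional_descent_step:
  fixes f :: "real ^ 'n \<Rightarrow> real"
  assumes convex: "convex_on UNIV f" and C2: "twice_cont_diff f"
    and bound: "\<And>z. f z \<le> f x \<Longrightarrow> d \<bullet> (hessian f z *v d) \<le> K"
    and "0 < K" and descent: "d \<bullet> gradient f x < 0"
  shows "f (x + (- (d \<bullet> gradient f x) / K) *\<^sub>R d) \<le> f x - (d \<bullet> gradient f x)\<^sup>2 / (2 * K)"
  using convex_descent_step[OF convex_on_line[OF convex] line_first_derivative[OF C2]
      line_second_derivative[OF C2], of x d K] bound \<open>0 < K\<close> descent
  by simp

section \<open>From block curvature to full curvature\<close>

text \<open>This is subadditivity of the seminorm given by the square root of a positive semidefinite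
  quadratic form: nonnegativity of the form at \<open>\<beta> x - \<alpha> y\<close> bounds the sum of the two cross terms
  \<open>x \<bullet> H y\<close> and \<open>y \<bullet> H x\<close> by \<open>2 \<alpha> \<beta>\<close>, as in the Cauchy-Schwarz inequality.\<close>

lemma psd_form_add:
  fixes H :: "real ^ 'n ^ 'n"
  assumes psd: "\<And>d. 0 \<le> d \<bullet> (H *v d)"
    and x: "x \<bullet> (H *v x) \<le> \<alpha>\<^sup>2" and y: "y \<bullet> (H *v y) \<le> \<beta>\<^sup>2"
    and "0 < \<alpha>" "0 < \<beta>"
  shows "(x + y) \<bullet> (H *v (x + y)) \<le> (\<alpha> + \<beta>)\<^sup>2"
proof -
  define s where "s = x \<bullet> (H *v y) + y \<bullet> (H *v x)"
  have "0 \<le> (\<beta> *\<^sub>R x - \<alpha> *\<^sub>R y) \<bullet> (H *v (\<beta> *\<^sub>R x - \<alpha> *\<^sub>R y))"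
    by (rule psd)
  also have "\<dots> = \<beta>\<^sup>2 * (x \<bullet> (H *v x)) + \<alpha>\<^sup>2 * (y \<bullet> (H *v y)) - \<alpha> * \<beta> * s"
    by (simp add: s_def matrix_vector_mult_diff_distrib matrix_vector_mult_scaleR
        inner_diff_left inner_diff_right power2_eq_square algebra_simps)
  finally have "\<alpha> * \<beta> * s \<le> \<beta>\<^sup>2 * (x \<bullet> (H *v x)) + \<alpha>\<^sup>2 * (y \<bullet> (H *v y))"
    by simp
  also have "\<dots> \<le> \<beta>\<^sup>2 * \<alpha>\<^sup>2 + \<alpha>\<^sup>2 * \<beta>\<^sup>2"
    using x y by (intro add_mono mult_left_mono) auto
  also have "\<dots> = \<alpha> * \<beta> * (2 * \<alpha> * \<beta>)"
    by (simp add: power2_eq_square)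
  finally have "s \<le> 2 * \<alpha> * \<beta>"
    using \<open>0 < \<alpha>\<close> \<open>0 < \<beta>\<close> by (simp add: mult_le_cancel_left_pos)
  then show ?thesis
    using x y unfolding s_def
    by (simp add: matrix_vector_right_distrib inner_add_left inner_add_right power2_sum)
qed

lemma psd_form_sum:
  fixes H :: "real ^ 'n ^ 'n"
  assumes psd: "\<And>d. 0 \<le> d \<bullet> (H *v d)"
    and "finite I" "I \<noteq> {}"
    and "\<And>i. i \<in> I \<Longrightarrow> x i \<bullet> (H *v x i) \<le> (\<alpha> i)\<^sup>2"
    and "\<And>i. i \<in> I \<Longrightarrow> 0 < \<alpha> i"
  shows "(\<Sum>i\<in>I. x i) \<bullet> (H *v (\<Sum>i\<in>I. x i)) \<le> (\<Sum>i\<in>I. \<alpha> i)\<^sup>2"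
  using assms(2-5)
proof (induction I rule: finite_ne_induct)
  case (insert i I)
  have "0 < (\<Sum>i\<in>I. \<alpha> i)"
    using insert by (intro sum_pos) auto
  then have "(x i + (\<Sum>i\<in>I. x i)) \<bullet> (H *v (x i + (\<Sum>i\<in>I. x i))) \<le> (\<alpha> i + (\<Sum>i\<in>I. \<alpha> i))\<^sup>2"
    using insert by (intro psd_form_add psd) auto
  with insert show ?case by simp
qed simp

lemma sum_if_mem:
  fixes g :: "'n::finite \<Rightarrow> real"
  shows "(\<Sum>i\<in>UNIV. if i \<in> B then g i else 0) = (\<Sum>i\<in>B. g i)"
  by (simp add: sum.If_cases)

lemma norm_zero_pad: "norm (zero_pad B z :: real ^ 'n) = L2_set z B"
proof -
  have "(\<Sum>i\<in>UNIV. (norm (zero_pad B z $ i :: real))\<^sup>2) = (\<Sum>i\<in>UNIV. if i \<in> B then (z i)\<^sup>2 else 0)"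
    by (intro sum.cong) (auto simp: zero_pad_def)
  also have "\<dots> = (\<Sum>i\<in>B. (z i)\<^sup>2)" by (rule sum_if_mem)
  finally show ?thesis by (simp add: norm_vec_def L2_set_def)
qed

lemma zero_pad_form:
  fixes f :: "real ^ 'n \<Rightarrow> real"
  shows "zero_pad B z \<bullet> (hessian f x *v zero_pad B z)
    = (\<Sum>i\<in>B. \<Sum>j\<in>B. z i * hessian_block f B x i j * z j)"
proof -
  have "zero_pad B z \<bullet> (hessian f x *v zero_pad B z)
      = (\<Sum>i\<in>UNIV. if i \<in> B then z i * (\<Sum>j\<in>UNIV. if j \<in> B then hessian f x $ i $ j * z j else 0) else 0)"
    unfolding inner_vec_def matrix_vector_mult_def
    by (intro sum.cong) (auto simp: zero_pad_def intro!: sum.cong)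
  also have "\<dots> = (\<Sum>i\<in>B. z i * (\<Sum>j\<in>B. hessian f x $ i $ j * z j))"
    by (simp only: sum_if_mem)
  also have "\<dots> = (\<Sum>i\<in>B. \<Sum>j\<in>B. z i * hessian_block f B x i j * z j)"
    by (auto simp: hessian_block_def sum_distrib_left mult.assoc intro!: sum.cong)
  finally show ?thesis .
qed

lemma scaled_id_form:
  fixes z :: "'n::finite \<Rightarrow> real"
  shows "(\<Sum>i\<in>B. \<Sum>j\<in>B. z i * scaled_id c i j * z j) = c * (\<Sum>i\<in>B. (z i)\<^sup>2)"
proof -
  have "(\<Sum>j\<in>B. z i * scaled_id c i j * z j) = c * (z i)\<^sup>2" if "i \<in> B" for i
  proof -
    have "(\<Sum>j\<in>B. z i * scaled_id c i j * z j) = (\<Sum>j\<in>B. if j = i then c * (z i)\<^sup>2 else 0)"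
      by (intro sum.cong) (auto simp: scaled_id_def power2_eq_square)
    then show ?thesis using that by simp
  qed
  then show ?thesis by (simp add: sum_distrib_left)
qed

lemma loewner_le_on_scaled_idD:
  fixes f :: "real ^ 'n \<Rightarrow> real"
  assumes "loewner_le_on B (hessian_block f B x) (scaled_id c)"
  shows "zero_pad B z \<bullet> (hessian f x *v zero_pad B z) \<le> c * (L2_set z B)\<^sup>2"
proof -
  have "0 \<le> (\<Sum>i\<in>B. \<Sum>j\<in>B. z i * (scaled_id c i j - hessian_block f B x i j) * z j)"
    using assms by (auto simp: loewner_le_on_def psd_on_def)
  also have "\<dots> = (\<Sum>i\<in>B. \<Sum>j\<in>B. z i * scaled_id c i j * z j) - zero_pad B z \<bullet> (hessian f x *v zero_pad B z)"
    by (simp add: zero_pad_form right_diff_distrib left_diff_distrib sum_subtractf)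
  finally show ?thesis
    by (simp add: scaled_id_form L2_set_def sum_nonneg)
qed

lemma loewner_le_on_scaled_id_mono:
  fixes A :: "'n::finite \<Rightarrow> 'n \<Rightarrow> real"
  assumes A: "loewner_le_on B A (scaled_id c)" and "c \<le> c'"
  shows "loewner_le_on B A (scaled_id c')"
  unfolding loewner_le_on_def psd_on_def
proof (intro conjI ballI allI)
  fix i j assume "i \<in> B" "j \<in> B"
  with A have "scaled_id c i j - A i j = scaled_id c j i - A j i"
    unfolding loewner_le_on_def psd_on_def by blast
  then show "scaled_id c' i j - A i j = scaled_id c' j i - A j i"
    by (auto simp: scaled_id_def split: if_splits)
next
  fix z :: "'n \<Rightarrow> real"
  have "0 \<le> (\<Sum>i\<in>B. \<Sum>j\<in>B. z i * (scaled_id c i j - A i j) * z j)"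
    using A by (auto simp: loewner_le_on_def psd_on_def)
  also have "\<dots> = c * (\<Sum>i\<in>B. (z i)\<^sup>2) - (\<Sum>i\<in>B. \<Sum>j\<in>B. z i * A i j * z j)"
    by (simp add: right_diff_distrib left_diff_distrib sum_subtractf scaled_id_form)
  also have "\<dots> \<le> c' * (\<Sum>i\<in>B. (z i)\<^sup>2) - (\<Sum>i\<in>B. \<Sum>j\<in>B. z i * A i j * z j)"
    using \<open>c \<le> c'\<close> by (intro diff_right_mono mult_right_mono) (auto simp: sum_nonneg)
  also have "\<dots> = (\<Sum>i\<in>B. \<Sum>j\<in>B. z i * (scaled_id c' i j - A i j) * z j)"
    by (simp add: right_diff_distrib left_diff_distrib sum_subtractf scaled_id_form)
  finally show "0 \<le> (\<Sum>i\<in>B. \<Sum>j\<in>B. z i * (scaled_id c' i j - A i j) * z j)" .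
qed

lemma sum_zero_pad_partition:
  fixes d :: "real ^ 'n"
  assumes "partition_on UNIV \<B>"
  shows "(\<Sum>B\<in>\<B>. zero_pad B (\<lambda>i. d $ i)) = d"
proof (rule vec_eq_iff[THEN iffD2], rule allI)
  fix i
  obtain B where B: "B \<in> \<B>" "i \<in> B"
    using partition_onD1[OF assms] by auto
  have "i \<notin> C" if "C \<in> \<B>" "C \<noteq> B" for C
    using disjointD[OF partition_onD2[OF assms] B(1) that(1)] that(2) B(2) by auto
  then have "(\<Sum>C\<in>\<B>. zero_pad C (\<lambda>i. d $ i) $ i) = (\<Sum>C\<in>\<B>. if C = B then d $ i else 0)"
    using B by (intro sum.cong) (auto simp: zero_pad_def)
  then show "(\<Sum>B\<in>\<B>. zero_pad B (\<lambda>i. d $ i)) $ i = d $ i"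
    using B by simp
qed

text \<open>Adding up the blocks of \<open>d\<close> in the Hessian seminorm, each of size at most
  \<open>sqrt (L B) * norm d\<close>, gives curvature at most the square of the sum of the \<open>sqrt (L B)\<close>.\<close>

lemma block_bounds_imp_hessian_bound:
  fixes f :: "real ^ 'n \<Rightarrow> real"
  assumes convex: "convex_on UNIV f" and C2: "twice_cont_diff f"
    and part: "partition_on UNIV \<B>"
    and L: "\<And>B. B \<in> \<B> \<Longrightarrow> 0 < L B"
    and blocks: "\<And>B. B \<in> \<B> \<Longrightarrow> loewner_le_on B (hessian_block f B x) (scaled_id (L B))"
  shows "d \<bullet> (hessian f x *v d) \<le> (\<Sum>B\<in>\<B>. sqrt (L B))\<^sup>2 * (norm d)\<^sup>2"
proof (cases "d = 0")
  case False
  let ?d = "\<lambda>B. zero_pad B (\<lambda>i. d $ i)"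
  have "\<B> \<noteq> {}" using partition_onD1[OF part] by auto
  have block: "?d B \<bullet> (hessian f x *v ?d B) \<le> (sqrt (L B) * norm d)\<^sup>2" if "B \<in> \<B>" for B
  proof -
    have "L2_set (\<lambda>i. d $ i) B \<le> norm d"
      unfolding norm_vec_def L2_set_def by (auto intro!: sum_mono2)
    then have "L B * (L2_set (\<lambda>i. d $ i) B)\<^sup>2 \<le> L B * (norm d)\<^sup>2"
      using L[OF that] by (intro mult_left_mono power_mono) (auto simp: L2_set_nonneg)
    also have "\<dots> = (sqrt (L B) * norm d)\<^sup>2"
      using L[OF that] by (simp add: power_mult_distrib)
    finally show ?thesis
      using loewner_le_on_scaled_idD[OF blocks[OF that]] by (rule order_trans[rotated])
  qed
  have "(\<Sum>B\<in>\<B>. ?d B) \<bullet> (hessian f x *v (\<Sum>B\<in>\<B>. ?d B)) \<le> (\<Sum>B\<in>\<B>. sqrt (L B) * norm d)\<^sup>2"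
    using \<open>\<B> \<noteq> {}\<close> False L block
    by (intro psd_form_sum convex_imp_hessian_nonneg[OF convex C2]) auto
  then show ?thesis
    by (simp add: sum_zero_pad_partition[OF part] power_mult_distrib flip: sum_distrib_right)
qed simp

section \<open>Growth and decrease within sublevel sets\<close>

text \<open>For a function with minimum value \<open>m\<close>, a descent step from \<open>w\<close> stays in the sublevel set of
  \<open>w\<close> and cannot go below \<open>m\<close>; this caps every directional derivative at \<open>w\<close>.\<close>

lemma directional_derivative_bound:
  fixes f :: "real ^ 'n \<Rightarrow> real"
  assumes convex: "convex_on UNIV f" and C2: "twice_cont_diff f"
    and lower: "\<And>z. m \<le> f z"
    and bound: "\<And>z. f z \<le> f w \<Longrightarrow> d \<bullet> (hessian f z *v d) \<le> K"
    and "0 < K"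
  shows "(d \<bullet> gradient f w)\<^sup>2 \<le> 2 * K * (f w - m)"
proof -
  have *: "(e \<bullet> gradient f w)\<^sup>2 \<le> 2 * K * (f w - m)"
    if "e \<bullet> gradient f w < 0" and "\<And>z. f z \<le> f w \<Longrightarrow> e \<bullet> (hessian f z *v e) \<le> K" for e
  proof -
    have "m \<le> f w - (e \<bullet> gradient f w)\<^sup>2 / (2 * K)"
      by (rule order_trans[OF lower convex_directional_descent_step[OF convex C2 that(2) \<open>0 < K\<close> that(1)]])
    then show ?thesis
      using \<open>0 < K\<close> by (simp add: field_simps)
  qed
  consider "d \<bullet> gradient f w < 0" | "d \<bullet> gradient f w = 0" | "(- d) \<bullet> gradient f w < 0"
    by fastforce
  then show ?thesis
  proof cases
    case 1
    then show ?thesis using * bound by blast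
  next
    case 2
    then show ?thesis using \<open>0 < K\<close> lower by simp
  next
    case 3
    have "(- d) \<bullet> (hessian f z *v (- d)) = d \<bullet> (hessian f z *v d)" for z
      using matrix_vector_mult_scaleR[of "hessian f z" "-1" d] by simp
    with 3 show ?thesis using *[of "- d"] bound by simp
  qed
qed

text \<open>With curvature at most \<open>2 \<Delta>\<close> along \<open>d\<close> below level \<open>m + 5 \<Delta>\<close>, and starting at most
  \<open>\<Delta>\<close> above the minimum, the three terms of the quadratic model contribute at most
  \<open>\<Delta>\<close>, \<open>2 \<Delta>\<close> and \<open>\<Delta>\<close>. Their sum is below \<open>5 \<Delta>\<close>, so the barrier argument applies.\<close>

lemma value_after_short_step:
  fixes f :: "real ^ 'n \<Rightarrow> real"
  assumes convex: "convex_on UNIV f" and C2: "twice_cont_diff f"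
    and lower: "\<And>z. m \<le> f z"
    and "0 < \<Delta>"
    and start: "f w \<le> m + \<Delta>"
    and bound: "\<And>z. f z \<le> m + 5 * \<Delta> \<Longrightarrow> d \<bullet> (hessian f z *v d) \<le> 2 * \<Delta>"
  shows "f (w + d) \<le> m + 4 * \<Delta>"
proof -
  have "(d \<bullet> gradient f w)\<^sup>2 \<le> 2 * (2 * \<Delta>) * (f w - m)"
    by (rule directional_derivative_bound[OF convex C2 lower])
       (use bound start \<open>0 < \<Delta>\<close> in auto)
  also have "\<dots> \<le> 2 * (2 * \<Delta>) * \<Delta>"
    using start \<open>0 < \<Delta>\<close> by (intro mult_left_mono) auto
  also have "\<dots> = (2 * \<Delta>)\<^sup>2" by (simp add: power2_eq_square)
  finally have slope: "d \<bullet> gradient f w \<le> 2 * \<Delta>"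
    by (rule power2_le_imp_le) (use \<open>0 < \<Delta>\<close> in simp)
  have model: "f w + (d \<bullet> gradient f w) * s + 2 * \<Delta> * s\<^sup>2 / 2 \<le> m + 4 * \<Delta>"
    if "0 \<le> s" "s \<le> 1" for s
  proof -
    have "(d \<bullet> gradient f w) * s \<le> 2 * \<Delta> * 1"
      using slope that \<open>0 < \<Delta>\<close> by (intro mult_mono) auto
    moreover have "\<Delta> * s\<^sup>2 \<le> \<Delta> * 1"
      using that \<open>0 < \<Delta>\<close> by (intro mult_left_mono power_le_one) auto
    ultimately show ?thesis using start by simp
  qed
  have "f (w + 1 *\<^sub>R d) \<le> m + 4 * \<Delta>"
    by (rule convex_Taylor_barrier[OF convex_on_line[OF convex] line_first_derivative[OF C2]
          line_second_derivative[OF C2], where R = "m + 5 * \<Delta>" and K = "2 * \<Delta>"])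
       (use bound model \<open>0 < \<Delta>\<close> in auto)
  then show ?thesis by simp
qed

text \<open>Along the negative padded block gradient both the slope and the curvature are multiples of
  the same squared norm \<open>G\<close>, namely \<open>- G\<close> and at most \<open>L * G\<close>, so the minimizer of the quadratic
  model is the step length \<open>1 / L\<close>, and the factor \<open>G\<close> cancels once from the predicted
  decrease \<open>G\<^sup>2 / (2 * L * G)\<close>.\<close>

lemma block_gradient_step:
  fixes f :: "real ^ 'n \<Rightarrow> real"
  assumes convex: "convex_on UNIV f" and C2: "twice_cont_diff f"
    and "0 < L"
    and block: "\<And>z. f z \<le> f y \<Longrightarrow> loewner_le_on B (hessian_block f B z) (scaled_id L)"
  shows "f (y - (1 / L) *\<^sub>R zero_pad B (gradient_block f B y))
    \<le> f y - (L2_set (gradient_block f B y) B)\<^sup>2 / (2 * L)"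
proof -
  let ?g = "gradient_block f B y"
  let ?p = "zero_pad B ?g"
  define G where "G = (L2_set ?g B)\<^sup>2"
  have norm_p: "?p \<bullet> ?p = G"
    by (simp add: G_def norm_zero_pad flip: power2_norm_eq_inner)
  have "?p \<bullet> gradient f y = ?p \<bullet> ?p"
    unfolding inner_vec_def by (intro sum.cong) (auto simp: zero_pad_def gradient_block_def)
  then have slope: "(- ?p) \<bullet> gradient f y = - G"
    using norm_p by simp
  show ?thesis
  proof (cases "G = 0")
    case True
    then have "?p = 0" using norm_p by simp
    with True show ?thesis by (simp add: G_def)
  next
    case False
    then have "0 < G" by (simp add: G_def)
    have curv: "(- ?p) \<bullet> (hessian f z *v (- ?p)) \<le> L * G" if "f z \<le> f y" for z
    proof -
      have "(- ?p) \<bullet> (hessian f z *v (- ?p)) = ?p \<bullet> (hessian f z *v ?p)"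
        using matrix_vector_mult_scaleR[of "hessian f z" "-1" ?p] by simp
      then show ?thesis
        using loewner_le_on_scaled_idD[OF block[OF that]] by (simp add: G_def)
    qed
    have "f (y + (- ((- ?p) \<bullet> gradient f y) / (L * G)) *\<^sub>R (- ?p))
        \<le> f y - ((- ?p) \<bullet> gradient f y)\<^sup>2 / (2 * (L * G))"
      by (rule convex_directional_descent_step[OF convex C2 curv])
         (use \<open>0 < L\<close> \<open>0 < G\<close> slope in auto)
    moreover have "- (- G) / (L * G) = 1 / L" "(- G)\<^sup>2 / (2 * (L * G)) = G / (2 * L)"
      using \<open>0 < G\<close> \<open>0 < L\<close> by (auto simp: power2_eq_square)
    ultimately show ?thesis unfolding slope G_def[symmetric] by simp
  qed
qed

theorem lemma4p1:
  fixes f F :: "real ^ 'm \<Rightarrow> real"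
    and ustar u v y :: "real ^ 'm"
    and \<B> :: "'m set set"
    and \<kappa> \<nu> Lbar :: "'m set \<Rightarrow> real"
    and C0 C1 T a P Tplus \<Delta> M :: real
  assumes convex: "convex_on UNIV f"
    and C2: "twice_cont_diff f"
    and minimizer: "\<And>x. f ustar \<le> f x"
    and F_def: "\<And>x. F x = f x - f ustar"
    and partition: "partition_on UNIV \<B>"
    and \<kappa>_nonneg: "\<And>B. B \<in> \<B> \<Longrightarrow> 0 \<le> \<kappa> B"
    and \<nu>_nonneg: "\<And>B. B \<in> \<B> \<Longrightarrow> 0 \<le> \<nu> B"
    and not_both_zero: "\<And>B. B \<in> \<B> \<Longrightarrow> \<not> (\<kappa> B = 0 \<and> \<nu> B = 0)"
    and hessian_lower: "\<And>B x. B \<in> \<B> \<Longrightarrow>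
          loewner_le_on B (scaled_id 0) (hessian_block f B x)"
    and hessian_upper: "\<And>B x. B \<in> \<B> \<Longrightarrow>
          loewner_le_on B (hessian_block f B x) (scaled_id (\<kappa> B + \<nu> B * F x))"
    and C0_def: "C0 = (\<Sum>B\<in>\<B>. sqrt (\<kappa> B))"
    and C1_def: "C1 = (\<Sum>B\<in>\<B>. sqrt (\<nu> B))"
    and T_pos: "T > 0" and a_pos: "a > 0" and P_pos: "P > 0"
    and Tplus_def: "Tplus = T + a"
    and \<Delta>_def: "\<Delta> = P / T"
    and M_def: "M = C0 + sqrt (5 * \<Delta>) * C1"
    and M_eq: "M\<^sup>2 * a\<^sup>2 = Tplus"
    and potential: "T * F u + 1 / 2 * (norm (v - ustar))\<^sup>2 \<le> P"
    and y_def: "y = (1 / Tplus) *\<^sub>R (T *\<^sub>R u + a *\<^sub>R v)"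
    and Lbar_def: "\<And>B. B \<in> \<B> \<Longrightarrow> sqrt (Lbar B) = sqrt (\<kappa> B) + sqrt (5 * \<nu> B * \<Delta>)"
  shows "F y \<le> 4 * \<Delta> \<and>
    (\<forall>B\<in>\<B>.
       loewner_le_on B (hessian_block f B y) (scaled_id (Lbar B)) \<and>
       f (y - (1 / Lbar B) *\<^sub>R zero_pad B (gradient_block f B y))
         \<le> f y - (L2_set (gradient_block f B y) B)\<^sup>2 / (2 * Lbar B))"
proof -
  have "0 < \<Delta>" using T_pos P_pos by (simp add: \<Delta>_def)
  have Tp: "0 < Tplus" "T \<le> Tplus" using T_pos a_pos by (auto simp: Tplus_def)
  have F_nonneg: "0 \<le> F x" for x using minimizer[of x] by (simp add: F_def)
  have Lbar_pos: "0 < Lbar B" if "B \<in> \<B>" for B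
  proof -
    have "0 \<le> sqrt (\<kappa> B)" "0 \<le> sqrt (5 * \<nu> B * \<Delta>)" "sqrt (\<kappa> B) \<noteq> 0 \<or> sqrt (5 * \<nu> B * \<Delta>) \<noteq> 0"
      using \<kappa>_nonneg[OF that] \<nu>_nonneg[OF that] not_both_zero[OF that] \<open>0 < \<Delta>\<close> by auto
    then have "0 < sqrt (Lbar B)"
      unfolding Lbar_def[OF that] by linarith
    then show ?thesis by simp
  qed
  have Lbar_ge: "\<kappa> B + \<nu> B * (5 * \<Delta>) \<le> Lbar B" if "B \<in> \<B>" for B
  proof -
    have "Lbar B = (sqrt (\<kappa> B) + sqrt (5 * \<nu> B * \<Delta>))\<^sup>2"
      using Lbar_pos[OF that] by (simp flip: Lbar_def[OF that])
    also have "\<dots> \<ge> (sqrt (\<kappa> B))\<^sup>2 + (sqrt (5 * \<nu> B * \<Delta>))\<^sup>2"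
      using \<kappa>_nonneg[OF that] \<nu>_nonneg[OF that] \<open>0 < \<Delta>\<close> by (simp add: power2_sum)
    finally show ?thesis
      using \<kappa>_nonneg[OF that] \<nu>_nonneg[OF that] \<open>0 < \<Delta>\<close> by (simp add: mult_ac)
  qed
  have block: "loewner_le_on B (hessian_block f B z) (scaled_id (Lbar B))"
    if "B \<in> \<B>" and "F z \<le> 5 * \<Delta>" for B z
  proof (rule loewner_le_on_scaled_id_mono[OF hessian_upper[OF \<open>B \<in> \<B>\<close>]])
    have "\<nu> B * F z \<le> \<nu> B * (5 * \<Delta>)"
      using that \<nu>_nonneg by (intro mult_left_mono) auto
    then show "\<kappa> B + \<nu> B * F z \<le> Lbar B" using Lbar_ge[OF \<open>B \<in> \<B>\<close>] by simp
  qed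
  \<comment> \<open>\<open>Lbar\<close> was chosen so that the root curvatures add up to \<open>M\<close>.\<close>
  have "M = (\<Sum>B\<in>\<B>. sqrt (Lbar B))"
    by (simp add: M_def C0_def C1_def Lbar_def sum.distrib sum_distrib_left real_sqrt_mult mult_ac)
  then have curv: "d \<bullet> (hessian f z *v d) \<le> M\<^sup>2 * (norm d)\<^sup>2" if "F z \<le> 5 * \<Delta>" for d z
    using block_bounds_imp_hessian_bound[OF convex C2 partition Lbar_pos block[OF _ that]] by simp

  \<comment> \<open>Replacing \<open>v\<close> by \<open>ustar\<close> in \<open>y\<close> gives a base point whose value is controlled.\<close>
  define w where "w = (1 / Tplus) *\<^sub>R (T *\<^sub>R u + a *\<^sub>R ustar)"
  define d where "d = (a / Tplus) *\<^sub>R (v - ustar)"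
  have y_eq: "y = w + d"
    by (simp add: y_def w_def d_def algebra_simps)
  have "0 \<le> T * F u" using F_nonneg[of u] T_pos by simp
  moreover have "0 \<le> (norm (v - ustar))\<^sup>2" by simp
  ultimately have Fu: "T * F u \<le> P" and v_dist: "(norm (v - ustar))\<^sup>2 \<le> 2 * P"
    using potential by linarith+
  have P_ratio: "P / Tplus \<le> \<Delta>"
    using Tp T_pos P_pos unfolding \<Delta>_def by (intro divide_left_mono) auto
  have "F w \<le> \<Delta>"
  proof -
    have weight: "1 - a / Tplus = T / Tplus"
      using Tp by (simp add: Tplus_def field_simps)
    have "f w \<le> (T / Tplus) * f u + (a / Tplus) * f ustar"
      using convex_onD[OF convex, of "a / Tplus" u ustar] a_pos T_pos
      unfolding weight by (simp add: w_def Tplus_def scaleR_add_right)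
    then have "F w \<le> (T / Tplus) * F u"
      unfolding F_def weight[symmetric] by (simp add: algebra_simps)
    also have "\<dots> = T * F u / Tplus" by simp
    also have "\<dots> \<le> P / Tplus" using Fu Tp by (intro divide_right_mono) auto
    finally show ?thesis using P_ratio by simp
  qed
  moreover have "M\<^sup>2 * (norm d)\<^sup>2 \<le> 2 * \<Delta>"
  proof -
    have "M\<^sup>2 * (norm d)\<^sup>2 = (M\<^sup>2 * a\<^sup>2) * (norm (v - ustar))\<^sup>2 / Tplus\<^sup>2"
      by (simp add: d_def power_mult_distrib power_divide)
    also have "\<dots> = (norm (v - ustar))\<^sup>2 / Tplus"
      using Tp unfolding M_eq by (simp add: power2_eq_square)
    also have "\<dots> \<le> 2 * P / Tplus"
      using v_dist Tp by (intro divide_right_mono) auto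
    finally show ?thesis using P_ratio by simp
  qed
  ultimately have "f (w + d) \<le> f ustar + 4 * \<Delta>"
    by (intro value_after_short_step[OF convex C2 minimizer \<open>0 < \<Delta>\<close>])
       (auto simp: F_def intro: order_trans[OF curv])
  then have Fy: "F y \<le> 4 * \<Delta>" by (simp add: F_def y_eq)
  have block_y: "loewner_le_on B (hessian_block f B z) (scaled_id (Lbar B))"
    if "B \<in> \<B>" and "f z \<le> f y" for B z
    using block[OF that(1), of z] that(2) Fy \<open>0 < \<Delta>\<close> by (simp add: F_def)
  show ?thesis
    using Fy block_y block_gradient_step[OF convex C2 Lbar_pos block_y] by blast
qed

end
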